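(* Suppose $r>1$ and $R=ae_1^\top\in\mathcal{B}_{n,r}$ is a singular point for some $a\in E^n$. Then its tangent cones are given by $$\mathcal{T}^i_{\mathcal{B}_{n,r}}(R)=\mathcal{T}_{\mathcal{B}_{n,r}}(R)=\left\{[0,H_1]:\ H_1\in\mathbb{R}^{n\times(r-1)},\ e^\top H_1=0,\ a^\top\mathrm{diag}(H_1H_1^\top)=0\right\}.$$
   Context: $\mathcal{B}_{n,r}:=\{R\in\mathbb{R}^{n\times r}:\ \mathrm{diag}(RR^\top)=e,\ R^\top e=0\}$, where $e\in\mathbb{R}^n$ is the all-ones vector and $\mathrm{diag}(X)$ is the diagonal vector of the square matrix $X$. $E^n:=\{v\in\{-1,1\}^n:e^\top v=0\}$; $e_1\in\mathbb{R}^r$ is the first standard basis vector. The points $ae_1^\top$ with $a\in E^n$ are singular points of $\mathcal{B}_{n,r}$ (LICQ fails there). $[0,H_1]$ denotes the $n\times r$ matrix with first column $0$ and remaining columns $H_1$. For a closed set $S$ and $x\in S$: inner tangent cone $\mathcal{T}^i_S(x):=\{h:\ \mathrm{dist}(x+th,S)=o(t),\ t\ge0\}$; contingent cone $\mathcal{T}_S(x):=\{h:\ \exists t_k\downarrow0,\ \mathrm{dist}(x+t_kh,S)=o(t_k)\}$. *)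

theory Defs
  imports "HOL-Analysis.Analysis" "HOL-Library.Landau_Symbols"
begin

text \<open>
  An \<open>n \<times> r\<close> matrix is an element of \<^typ>\<open>real^'r^'n\<close> (rows indexed by \<open>'n\<close>, columns by
  \<open>'r\<close>); its norm is the Frobenius norm.  Matrices with a distinguished first column are indexed
  by \<^typ>\<open>'m option\<close>: the first column is \<^term>\<open>None\<close> and the others are \<^term>\<open>Some k\<close>.  So
  \<open>r = CARD('m) + 1\<close> ranges over all \<open>r > 1\<close> and \<open>H\<^sub>1\<close>, with \<open>r - 1\<close> columns, is in
  \<^typ>\<open>real^'m^'n\<close>.
\<close>

definition all_ones :: "real^'n" where
  "all_ones = (\<chi> i. 1)"

definition diag_vec :: "real^'n^'n \<Rightarrow> real^'n" where
  "diag_vec X = (\<chi> i. X $ i $ i)"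

definition outer :: "real^'n \<Rightarrow> real^'r \<Rightarrow> real^'r^'n" where
  "outer u v = (\<chi> i j. u $ i * v $ j)"

definition \<B> :: "(real^'r^'n) set" where
  "\<B> = {R. diag_vec (R ** transpose R) = all_ones \<and> transpose R *v all_ones = 0}"

definition balanced_signs :: "(real^'n) set" where
  "balanced_signs = {v. (\<forall>i. v $ i \<in> {-1, 1}) \<and> all_ones \<bullet> v = 0}"

definition first_basis :: "real^('m::finite option)" where
  "first_basis = axis None 1"

definition prepend_zero_col :: "real^'m^'n \<Rightarrow> real^('m::finite option)^'n" where
  "prepend_zero_col H = (\<chi> i j. case j of None \<Rightarrow> 0 | Some k \<Rightarrow> H $ i $ k)"


text \<open>
  The \<open>n + r\<close> scalar equality constraints \<open>diag (R R\<^sup>T) - e = 0\<close> and \<open>R\<^sup>T e = 0\<close> defining \<^term>\<open>\<B>\<close>.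
\<close>

definition constraint :: "'n + 'r \<Rightarrow> real^'r^'n \<Rightarrow> real" where
  "constraint c R = (case c of
      Inl i \<Rightarrow> (diag_vec (R ** transpose R) - all_ones) $ i
    | Inr j \<Rightarrow> (transpose R *v all_ones) $ j)"

text \<open>
  Linear independence is that of the indexed family of gradients, so two equal gradients
  count as dependent.
\<close>

definition LICQ :: "real^'r^'n \<Rightarrow> bool" where
  "LICQ R \<longleftrightarrow> (\<exists>g :: 'n + 'r \<Rightarrow> real^'r^'n.
     (\<forall>c. GDERIV (constraint c) R :> g c) \<and>
     (\<forall>\<mu>. (\<Sum>c\<in>UNIV. \<mu> c *\<^sub>R g c) = 0 \<longrightarrow> (\<forall>c. \<mu> c = 0)))"

definition singular_point :: "real^'r^'n \<Rightarrow> bool" where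
  "singular_point R \<longleftrightarrow> R \<in> \<B> \<and> \<not> LICQ R"


text \<open>
  Both cones are meant for closed \<open>S\<close> and \<open>x \<in> S\<close>; \<^const>\<open>infdist\<close> is then the usual
  point-to-set distance (for \<open>S = {}\<close> it is \<open>0\<close> by convention).
\<close>

definition inner_tangent_cone :: "'a::real_normed_vector set \<Rightarrow> 'a \<Rightarrow> 'a set" where
  "inner_tangent_cone S x =
     {h. (\<lambda>t::real. infdist (x + t *\<^sub>R h) S) \<in> o[at_right 0](\<lambda>t. t)}"

definition contingent_cone :: "'a::real_normed_vector set \<Rightarrow> 'a \<Rightarrow> 'a set" where
  "contingent_cone S x =
     {h. \<exists>t :: nat \<Rightarrow> real. (\<forall>k. t k > 0) \<and> t \<longlonglongrightarrow> 0 \<and>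
           (\<lambda>k. infdist (x + t k *\<^sub>R h) S) \<in> o[sequentially](t)}"

end

theory Submission
  imports Defs "HOL-Real_Asymp.Real_Asymp"
begin

text \<open>
  Write a matrix near \<open>R = a e\<^sub>1\<^sup>T\<close> by its rows: row \<open>i\<close> is a unit vector near \<open>\<plusminus>e\<^sub>1\<close>, and the
  rows sum to zero.  The inner cone is always inside the contingent cone, so two
  inclusions remain; let \<open>K\<close> be the claimed cone and \<open>h\<^sub>i\<close> the rows of \<open>H\<^sub>1\<close>.

  \<^emph>\<open>Contingent cone inside \<open>K\<close>\<close> (\<open>contingent_cone_necessary\<close>).  Let \<open>R + t u \<in> \<B>\<close>.
  Both \<open>R\<close> and \<open>R + t u\<close> have unit rows, so row \<open>i\<close> gives the exact identity
  \<open>2 a\<^sub>i u\<^sub>i\<^sub>1 + t |u\<^sub>i|\<^sup>2 = 0\<close>.  Letting \<open>t \<rightarrow> 0\<close> kills the first column.  Multiplying by \<open>a\<^sub>i = \<plusminus>1\<close>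
  and summing over \<open>i\<close>, the first terms cancel because the first column of \<open>u\<close> sums to zero;
  after division by \<open>t\<close> there remains \<open>\<Sum>\<^sub>i a\<^sub>i |u\<^sub>i|\<^sup>2 = 0\<close>, which survives in the limit.

  \<^emph>\<open>\<open>K\<close> inside the inner cone\<close> (\<open>prepend_zero_col_in_inner_tangent_cone\<close>).  Rows
  \<open>(a\<^sub>i sqrt (1 - t\<^sup>2 |z\<^sub>i|\<^sup>2), t z\<^sub>i)\<close> with \<open>\<Sum>\<^sub>i z\<^sub>i = 0\<close> form a point of \<open>\<B>\<close> as soon as the single
  scalar equation \<open>\<Sum>\<^sub>i a\<^sub>i sqrt (1 - t\<^sup>2 |z\<^sub>i|\<^sup>2) = 0\<close> holds.  To second order in \<open>t\<close> its
  left-hand side is \<open>- t\<^sup>2/2\<close> times the quadratic form \<open>q z = \<Sum>\<^sub>i a\<^sub>i |z\<^sub>i|\<^sup>2\<close>, and \<open>q h = 0\<close>.  Let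
  \<open>d\<^sub>i = a\<^sub>i h\<^sub>i - c\<close> with \<open>c\<close> the mean of the \<open>a\<^sub>i h\<^sub>i\<close>; up to a factor this is the gradient of \<open>q\<close> at
  \<open>h\<close>, projected to the space \<open>\<Sum>\<^sub>i z\<^sub>i = 0\<close>.  If \<open>d \<noteq> 0\<close>, then \<open>q\<close> changes sign along \<open>h + s d\<close> at
  \<open>s = 0\<close>, so by the intermediate value theorem the scalar equation has a solution with \<open>s\<close> as
  small as desired once \<open>t\<close> is small.  If \<open>d = 0\<close>, then \<open>h\<^sub>i = a\<^sub>i c\<close> with \<open>c\<close> independent of \<open>i\<close>,
  all \<open>|h\<^sub>i|\<close> agree, and \<open>z = h\<close> solves the equation exactly because \<open>\<Sum>\<^sub>i a\<^sub>i = 0\<close>.  So the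
  degenerate zeros of \<open>q\<close>, where the first-order argument is not available, are harmless.
\<close>

section \<open>Rows of a matrix, split at the first column\<close>

definition row_cons :: "real \<Rightarrow> real^'m \<Rightarrow> real^('m::finite option)" where
  "row_cons x y = (\<chi> j. case j of None \<Rightarrow> x | Some k \<Rightarrow> y $ k)"

definition row_tail :: "real^('m::finite option) \<Rightarrow> real^'m" where
  "row_tail v = (\<chi> k. v $ Some k)"

lemma row_cons_nth [simp]:
  "row_cons x y $ None = x" "row_cons x y $ Some k = y $ k"
  by (simp_all add: row_cons_def)

lemma row_cons_eq_iff: "v = row_cons x y \<longleftrightarrow> v $ None = x \<and> (\<forall>k. v $ Some k = y $ k)"
  by (auto simp: vec_eq_iff row_cons_def split: option.split)

lemma row_cons_collapse: "row_cons (v $ None) (row_tail v) = v"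
  by (metis row_cons_eq_iff row_tail_def vec_lambda_beta)

lemma inner_row_cons: "row_cons x y \<bullet> row_cons x' y' = x * x' + y \<bullet> y'"
  by (simp add: inner_vec_def UNIV_option_conv sum.reindex)

lemma norm_row_cons_squared: "(norm (row_cons x y))\<^sup>2 = x\<^sup>2 + (norm y)\<^sup>2"
  unfolding power2_norm_eq_inner inner_row_cons by (simp add: power2_eq_square)

lemma norm_row_cons_le: "norm (row_cons x y) \<le> \<bar>x\<bar> + norm y"
proof (rule power2_le_imp_le)
  show "(norm (row_cons x y))\<^sup>2 \<le> (\<bar>x\<bar> + norm y)\<^sup>2"
    by (simp add: norm_row_cons_squared power2_sum)
qed simp

lemma prepend_zero_col_nth: "prepend_zero_col H $ i = row_cons 0 (H $ i)"
  by (simp add: prepend_zero_col_def row_cons_def)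

lemma outer_first_basis_nth: "outer a first_basis $ i = row_cons (a $ i) 0"
  by (simp add: outer_def first_basis_def row_cons_eq_iff axis_def)

lemma norm_matrix_le_sum_rows: "norm (A :: real^'r^'n) \<le> (\<Sum>i\<in>UNIV. norm (A $ i))"
  unfolding norm_vec_def by (rule L2_set_le_sum) simp

lemma mem_\<B>_iff: "P \<in> \<B> \<longleftrightarrow> (\<forall>i. norm (P $ i) = 1) \<and> (\<Sum>i\<in>UNIV. P $ i) = 0"
proof -
  have "diag_vec (P ** transpose P) $ i = (norm (P $ i))\<^sup>2" for i
    by (simp add: diag_vec_def matrix_matrix_mult_def transpose_def power2_norm_eq_inner
        inner_vec_def)
  then have 1: "diag_vec (P ** transpose P) = all_ones \<longleftrightarrow> (\<forall>i. norm (P $ i) = 1)"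
    by (simp add: vec_eq_iff all_ones_def power2_eq_1_iff)
      (metis norm_ge_zero not_one_le_zero neg_0_le_iff_le)
  have "transpose P *v all_ones = (\<Sum>i\<in>UNIV. P $ i)"
    by (simp add: vec_eq_iff matrix_vector_mult_def transpose_def all_ones_def)
  with 1 show ?thesis by (simp add: \<B>_def)
qed

lemma closed_\<B>: "closed (\<B> :: (real^'r^'n) set)"
proof -
  have "\<B> = (\<Inter>i. {P :: real^'r^'n. norm (P $ i) = 1}) \<inter> {P. (\<Sum>i\<in>UNIV. P $ i) = 0}"
    by (auto simp: mem_\<B>_iff)
  also have "closed \<dots>"
    by (intro closed_Int closed_INT ballI closed_Collect_eq continuous_intros)
  finally show ?thesis .
qed

lemma all_ones_vector_matrix_mult: "all_ones v* H = (\<Sum>i\<in>UNIV. H $ i)"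
  by (simp add: vec_eq_iff vector_matrix_mult_def all_ones_def)

lemma inner_diag_gram: "a \<bullet> diag_vec (H ** transpose H) = (\<Sum>i\<in>UNIV. a $ i * (norm (H $ i))\<^sup>2)"
  by (simp add: inner_vec_def diag_vec_def matrix_matrix_mult_def transpose_def
      power2_norm_eq_inner)

lemma balanced_signsD:
  assumes "a \<in> balanced_signs"
  shows "a $ i * a $ i = 1" and "\<bar>a $ i\<bar> = 1" and "(\<Sum>i\<in>UNIV. a $ i) = 0"
proof -
  have "a $ i = -1 \<or> a $ i = 1"
    using assms by (auto simp: balanced_signs_def)
  then show "a $ i * a $ i = 1" "\<bar>a $ i\<bar> = 1" by auto
  show "(\<Sum>i\<in>UNIV. a $ i) = 0"
    using assms by (simp add: balanced_signs_def all_ones_def inner_vec_def)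
qed

section \<open>Tangent cones\<close>

lemma inner_tangent_cone_subset_contingent_cone: "inner_tangent_cone S x \<subseteq> contingent_cone S x"
proof
  fix h assume h: "h \<in> inner_tangent_cone S x"
  define t where "t = (\<lambda>k. 1 / real (Suc k))"
  have lim: "filterlim t (at_right 0) sequentially"
    unfolding t_def by real_asymp
  have "(\<lambda>k. infdist (x + t k *\<^sub>R h) S) \<in> o(t)"
    using landau_o.small.compose[OF _ lim] h by (simp add: inner_tangent_cone_def)
  moreover have "t \<longlonglongrightarrow> 0"
    using lim by (simp add: filterlim_at)
  moreover have "t k > 0" for k
    by (simp add: t_def)
  ultimately show "h \<in> contingent_cone S x"
    by (auto simp: contingent_cone_def)
qed

text \<open>The distances to a closed set are attained, so the nearest points provide secants of the
  set that converge to a given contingent vector.\<close>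

lemma contingent_cone_secantE:
  fixes S :: "'a::euclidean_space set"
  assumes "closed S" "x \<in> S" "h \<in> contingent_cone S x"
  obtains t u where "\<And>k. t k > (0::real)" "t \<longlonglongrightarrow> 0" "u \<longlonglongrightarrow> h" "\<And>k. x + t k *\<^sub>R u k \<in> S"
proof -
  obtain t where t: "\<And>k. t k > (0::real)" "t \<longlonglongrightarrow> 0"
    and o: "(\<lambda>k. infdist (x + t k *\<^sub>R h) S) \<in> o(t)"
    using assms by (auto simp: contingent_cone_def)
  have "\<exists>p\<in>S. infdist (x + t k *\<^sub>R h) S = dist (x + t k *\<^sub>R h) p" for k
    using infdist_attains_inf[of S "x + t k *\<^sub>R h"] assms by blast
  then obtain p where p: "\<And>k. p k \<in> S"
    "\<And>k. infdist (x + t k *\<^sub>R h) S = dist (x + t k *\<^sub>R h) (p k)"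
    by metis
  define u where "u = (\<lambda>k. (p k - x) /\<^sub>R t k)"
  have xu: "x + t k *\<^sub>R u k = p k" for k
    using t(1)[of k] by (simp add: u_def)
  have "dist (u k) h = infdist (x + t k *\<^sub>R h) S / t k" for k
  proof -
    have "dist (x + t k *\<^sub>R h) (x + t k *\<^sub>R u k) = t k * dist (u k) h"
      using t(1)[of k] by (simp add: dist_norm norm_minus_commute flip: scaleR_diff_right)
    then show ?thesis
      using t(1)[of k] by (simp add: p(2) xu)
  qed
  then have "(\<lambda>k. dist (u k) h) \<longlonglongrightarrow> 0"
    using smalloD_tendsto[OF o] by simp
  then have "u \<longlonglongrightarrow> h"
    by (simp add: tendsto_dist_iff[of u])
  then show ?thesis
    using that t xu p(1) by metis
qed

section \<open>Necessary conditions\<close>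

lemma contingent_cone_necessary:
  fixes a :: "real^'n" and H :: "real^('m::finite option)^'n"
  assumes a: "a \<in> balanced_signs" and R: "outer a first_basis \<in> (\<B> :: (real^('m option)^'n) set)"
    and H: "H \<in> contingent_cone \<B> (outer a first_basis)"
  shows "H $ i $ None = 0" and "(\<Sum>i\<in>UNIV. H $ i) = 0"
    and "(\<Sum>i\<in>UNIV. a $ i * (norm (H $ i))\<^sup>2) = 0"
proof -
  let ?R = "outer a first_basis :: real^('m option)^'n"
  obtain t u where t: "\<And>k. t k > (0::real)" "t \<longlonglongrightarrow> 0" and u: "u \<longlonglongrightarrow> H"
    and P: "\<And>k. ?R + t k *\<^sub>R u k \<in> \<B>"
    by (rule contingent_cone_secantE[OF closed_\<B> R H]) (rule that)

  have first: "u k $ i $ None = - (a $ i * t k * (norm (u k $ i))\<^sup>2 / 2)" for k i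
  proof -
    have "norm (?R $ i) = 1" "norm (?R $ i + t k *\<^sub>R u k $ i) = 1"
      using R P[of k] by (auto simp: mem_\<B>_iff)
    then have "2 * t k * (?R $ i \<bullet> u k $ i) + (t k)\<^sup>2 * (norm (u k $ i))\<^sup>2 = 0"
      using dot_norm[of "?R $ i" "t k *\<^sub>R u k $ i"] by (simp add: power_mult_distrib)
    moreover have "?R $ i \<bullet> u k $ i = a $ i * u k $ i $ None"
      using inner_row_cons[of "a $ i" 0 "u k $ i $ None" "row_tail (u k $ i)"]
      by (simp add: row_cons_collapse outer_first_basis_nth)
    ultimately have "t k * (2 * (a $ i * u k $ i $ None) + t k * (norm (u k $ i))\<^sup>2) = 0"
      by (simp add: algebra_simps power2_eq_square)
    then have "a $ i * u k $ i $ None = - (t k * (norm (u k $ i))\<^sup>2 / 2)"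
      using t(1)[of k] by simp
    then have "a $ i * a $ i * u k $ i $ None = - (a $ i * t k * (norm (u k $ i))\<^sup>2 / 2)"
      by (simp add: mult.assoc)
    then show ?thesis by (simp add: balanced_signsD[OF a])
  qed

  have "(\<lambda>k. u k $ i $ None) \<longlonglongrightarrow> - (a $ i * 0 * (norm (H $ i))\<^sup>2 / 2)"
    unfolding first by (intro tendsto_intros t u) simp
  moreover have "(\<lambda>k. u k $ i $ None) \<longlonglongrightarrow> H $ i $ None"
    by (intro tendsto_vec_nth u)
  ultimately have "- (a $ i * 0 * (norm (H $ i))\<^sup>2 / 2) = H $ i $ None"
    by (rule LIMSEQ_unique)
  then show "H $ i $ None = 0" by simp

  have sum0: "(\<Sum>i\<in>UNIV. u k $ i) = 0" for k
  proof -
    have "t k *\<^sub>R (\<Sum>i\<in>UNIV. u k $ i) = 0"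
      using R P[of k] by (simp add: mem_\<B>_iff sum.distrib flip: scaleR_sum_right)
    then show ?thesis using t(1)[of k] by simp
  qed
  have "(\<lambda>k. \<Sum>i\<in>UNIV. u k $ i) \<longlonglongrightarrow> (\<Sum>i\<in>UNIV. H $ i)"
    by (intro tendsto_intros u)
  then show "(\<Sum>i\<in>UNIV. H $ i) = 0"
    unfolding sum0 by (simp add: LIMSEQ_const_iff)

  have quad0: "(\<Sum>i\<in>UNIV. a $ i * (norm (u k $ i))\<^sup>2) = 0" for k
  proof -
    have "(\<Sum>i\<in>UNIV. u k $ i $ None) = 0"
      using arg_cong[OF sum0[of k], of "\<lambda>v. v $ None"] by simp
    then have "- (t k / 2) * (\<Sum>i\<in>UNIV. a $ i * (norm (u k $ i))\<^sup>2) = 0"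
      unfolding first sum_distrib_left by (simp add: algebra_simps)
    then show ?thesis using t(1)[of k] by simp
  qed
  have "(\<lambda>k. \<Sum>i\<in>UNIV. a $ i * (norm (u k $ i))\<^sup>2) \<longlonglongrightarrow> (\<Sum>i\<in>UNIV. a $ i * (norm (H $ i))\<^sup>2)"
    by (intro tendsto_intros u)
  then show "(\<Sum>i\<in>UNIV. a $ i * (norm (H $ i))\<^sup>2) = 0"
    unfolding quad0 by (simp add: LIMSEQ_const_iff)
qed

section \<open>Sufficient conditions\<close>

text \<open>
  The rows \<open>z\<^sub>i\<close> correct the rows of \<open>H\<close>.  Placing \<open>t z\<^sub>i\<close> in the last columns and completing each
  row to a unit vector gives a point of \<open>\<B>\<close>; completing costs only \<open>O(t\<^sup>2)\<close>, the correction
  itself costs \<open>t |z - h|\<close>.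
\<close>

lemma infdist_\<B>_le:
  fixes a :: "real^'n" and H :: "real^'m^'n" and z :: "'n \<Rightarrow> real^'m"
  assumes a: "a \<in> balanced_signs" and t: "t \<ge> 0" and small: "\<And>i. t * norm (z i) \<le> 1"
    and z0: "(\<Sum>i\<in>UNIV. z i) = 0"
    and eq: "(\<Sum>i\<in>UNIV. a $ i * sqrt (1 - t\<^sup>2 * (norm (z i))\<^sup>2)) = 0"
  shows "infdist (outer a first_basis + t *\<^sub>R prepend_zero_col H) \<B>
           \<le> t\<^sup>2 * (\<Sum>i\<in>UNIV. (norm (z i))\<^sup>2) + t * (\<Sum>i\<in>UNIV. norm (z i - H $ i))"
proof -
  define w where "w = (\<lambda>i. sqrt (1 - t\<^sup>2 * (norm (z i))\<^sup>2))"
  define P :: "real^('m option)^'n" where "P = (\<chi> i. row_cons (a $ i * w i) (t *\<^sub>R z i))"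
  have le1: "t\<^sup>2 * (norm (z i))\<^sup>2 \<le> 1" for i
    using power_mono[OF small[of i], of 2] t by (simp add: power_mult_distrib)
  have w2: "(w i)\<^sup>2 = 1 - t\<^sup>2 * (norm (z i))\<^sup>2" for i
    using le1[of i] by (simp add: w_def)
  have w: "0 \<le> w i" "w i \<le> 1" for i
    using le1[of i] by (auto simp: w_def)
  have "P \<in> \<B>"
  proof -
    have "(norm (P $ i))\<^sup>2 = 1" for i
      using balanced_signsD(1)[OF a, of i] w2[of i]
      by (simp add: P_def norm_row_cons_squared power_mult_distrib power2_eq_square[of "a $ i"])
    then have "norm (P $ i) = 1" for i
      by (metis norm_ge_zero one_power2 power2_eq_imp_eq zero_le_one)
    moreover have "(\<Sum>i\<in>UNIV. P $ i) = row_cons 0 0"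
    proof -
      have "(\<Sum>i\<in>UNIV. z i $ k) = 0" for k
        using arg_cong[OF z0, of "\<lambda>v. v $ k"] by simp
      then show ?thesis
        using eq by (simp add: row_cons_eq_iff P_def w_def flip: sum_distrib_left)
    qed
    moreover have "row_cons 0 0 = (0 :: real^('m option))"
      by (metis row_cons_eq_iff zero_index)
    ultimately show ?thesis by (simp add: mem_\<B>_iff)
  qed
  then have "infdist (outer a first_basis + t *\<^sub>R prepend_zero_col H) \<B>
      \<le> norm (outer a first_basis + t *\<^sub>R prepend_zero_col H - P)"
    by (metis infdist_le dist_norm)
  also have "\<dots> \<le> (\<Sum>i\<in>UNIV. t\<^sup>2 * (norm (z i))\<^sup>2 + t * norm (z i - H $ i))"
  proof (rule order_trans[OF norm_matrix_le_sum_rows sum_mono])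
    fix i
    have "(outer a first_basis + t *\<^sub>R prepend_zero_col H - P) $ i
        = row_cons (a $ i * (1 - w i)) (t *\<^sub>R (H $ i - z i))"
      by (simp add: row_cons_eq_iff outer_first_basis_nth prepend_zero_col_nth P_def algebra_simps)
    then have "norm ((outer a first_basis + t *\<^sub>R prepend_zero_col H - P) $ i)
        \<le> \<bar>a $ i * (1 - w i)\<bar> + norm (t *\<^sub>R (H $ i - z i))"
      using norm_row_cons_le by metis
    also have "\<bar>a $ i * (1 - w i)\<bar> = 1 - w i"
      using w[of i] balanced_signsD(2)[OF a, of i] by (simp add: abs_mult)
    also have "1 - w i \<le> t\<^sup>2 * (norm (z i))\<^sup>2"
      using w[of i] w2[of i] mult_left_le[of "w i" "w i"] by (simp add: power2_eq_square)
    finally show "norm ((outer a first_basis + t *\<^sub>R prepend_zero_col H - P) $ i)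
        \<le> t\<^sup>2 * (norm (z i))\<^sup>2 + t * norm (z i - H $ i)"
      using t by (simp add: norm_minus_commute)
  qed
  also have "\<dots> = t\<^sup>2 * (\<Sum>i\<in>UNIV. (norm (z i))\<^sup>2) + t * (\<Sum>i\<in>UNIV. norm (z i - H $ i))"
    by (simp add: sum.distrib sum_distrib_left)
  finally show ?thesis .
qed

text \<open>Second-order expansion of the remaining scalar constraint; its constant term vanishes
  because the signs are balanced.\<close>

lemma scalar_constraint_expansion:
  fixes a :: "real^'n"
  assumes "a \<in> balanced_signs"
  shows "((\<lambda>t. (\<Sum>i\<in>UNIV. a $ i * sqrt (1 - t\<^sup>2 * m i)) / t\<^sup>2)
           \<longlongrightarrow> - (\<Sum>i\<in>UNIV. a $ i * m i) / 2) (at_right 0)"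
proof -
  have lim: "((\<lambda>t::real. (sqrt (1 - t\<^sup>2 * c) - 1) / t\<^sup>2) \<longlongrightarrow> - c / 2) (at_right 0)" for c
    by real_asymp
  have "((\<lambda>t. \<Sum>i\<in>UNIV. a $ i * ((sqrt (1 - t\<^sup>2 * m i) - 1) / t\<^sup>2))
      \<longlongrightarrow> (\<Sum>i\<in>UNIV. a $ i * (- m i / 2))) (at_right 0)"
    by (intro tendsto_intros lim)
  also have "(\<lambda>t. \<Sum>i\<in>UNIV. a $ i * ((sqrt (1 - t\<^sup>2 * m i) - 1) / t\<^sup>2))
      = (\<lambda>t. (\<Sum>i\<in>UNIV. a $ i * sqrt (1 - t\<^sup>2 * m i)) / t\<^sup>2)"
    using balanced_signsD(3)[OF assms]
    by (simp add: sum_divide_distrib[symmetric] right_diff_distrib sum_subtractf)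
  also have "(\<Sum>i\<in>UNIV. a $ i * (- m i / 2)) = - (\<Sum>i\<in>UNIV. a $ i * m i) / 2"
    by (simp add: sum_divide_distrib sum_negf)
  finally show ?thesis .
qed

text \<open>
  Along a line \<open>h + s d\<close> that crosses the zero set of the quadratic form transversally at \<open>s = 0\<close>,
  the form has opposite strict signs at \<open>s = \<plusminus>\<epsilon>\<close>.  By the expansion the scalar constraint
  inherits these signs for all small \<open>t\<close>, hence vanishes somewhere in between.
\<close>

lemma scalar_constraint_solvable:
  fixes a :: "real^'n" and h d :: "'n \<Rightarrow> real^'m"
  assumes a: "a \<in> balanced_signs"
    and q: "(\<Sum>i\<in>UNIV. a $ i * (norm (h i))\<^sup>2) = 0"
    and b: "(\<Sum>i\<in>UNIV. a $ i * (h i \<bullet> d i)) > 0"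
    and "\<delta> > 0"
  obtains \<epsilon> where "0 < \<epsilon>" "\<epsilon> \<le> \<delta>"
    "\<forall>\<^sub>F t in at_right 0. \<exists>s. \<bar>s\<bar> \<le> \<epsilon> \<and>
       (\<Sum>i\<in>UNIV. a $ i * sqrt (1 - t\<^sup>2 * (norm (h i + s *\<^sub>R d i))\<^sup>2)) = 0"
proof -
  define B where "B = (\<Sum>i\<in>UNIV. a $ i * (h i \<bullet> d i))"
  define Q where "Q = (\<Sum>i\<in>UNIV. a $ i * (norm (d i))\<^sup>2)"
  define g where "g = (\<lambda>t s. \<Sum>i\<in>UNIV. a $ i * sqrt (1 - t\<^sup>2 * (norm (h i + s *\<^sub>R d i))\<^sup>2))"
  have B: "B > 0" using b by (simp add: B_def)
  have form: "(\<Sum>i\<in>UNIV. a $ i * (norm (h i + s *\<^sub>R d i))\<^sup>2) = s * (2 * B + s * Q)" for s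
  proof -
    have "(\<Sum>i\<in>UNIV. a $ i * (norm (h i + s *\<^sub>R d i))\<^sup>2)
        = (\<Sum>i\<in>UNIV. a $ i * (norm (h i))\<^sup>2 + 2 * s * (a $ i * (h i \<bullet> d i))
              + s\<^sup>2 * (a $ i * (norm (d i))\<^sup>2))"
      unfolding power2_norm_eq_inner
      by (intro sum.cong refl)
        (simp add: inner_add_left inner_add_right inner_commute algebra_simps power2_eq_square)
    also have "\<dots> = 2 * s * B + s\<^sup>2 * Q"
      unfolding sum.distrib q by (simp add: B_def Q_def flip: sum_distrib_left)
    finally show ?thesis by (simp add: algebra_simps power2_eq_square)
  qed
  \<comment> \<open>The linear term dominates the form for \<open>\<bar>s\<bar> \<bar>Q\<bar> < B\<close>.\<close>
  define \<epsilon> where "\<epsilon> = min \<delta> (B / (\<bar>Q\<bar> + 1))"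
  have \<epsilon>: "0 < \<epsilon>" "\<epsilon> \<le> \<delta>"
    using B \<open>\<delta> > 0\<close> by (auto simp: \<epsilon>_def)
  have "\<epsilon> * (\<bar>Q\<bar> + 1) \<le> B"
  proof -
    have "\<epsilon> \<le> B / (\<bar>Q\<bar> + 1)" by (simp add: \<epsilon>_def)
    then show ?thesis by (subst (asm) pos_le_divide_eq) auto
  qed
  then have "\<bar>\<epsilon> * Q\<bar> \<le> B"
    using \<epsilon>(1) by (simp add: abs_mult distrib_left)
  then have pos: "2 * B + \<epsilon> * Q > 0" "2 * B + (- \<epsilon>) * Q > 0"
    using B by (auto simp: abs_le_iff)
  have lim: "((\<lambda>t. g t s / t\<^sup>2) \<longlongrightarrow> - (s * (2 * B + s * Q)) / 2) (at_right 0)" for s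
    using scalar_constraint_expansion[OF a, of "\<lambda>i. (norm (h i + s *\<^sub>R d i))\<^sup>2"]
    by (simp add: g_def form)
  have "\<forall>\<^sub>F t in at_right 0. g t \<epsilon> / t\<^sup>2 < 0"
    by (rule order_tendstoD(2)[OF lim]) (use pos \<epsilon>(1) in simp)
  moreover have "\<forall>\<^sub>F t in at_right 0. g t (- \<epsilon>) / t\<^sup>2 > 0"
    by (rule order_tendstoD(1)[OF lim]) (use mult_pos_pos[OF \<epsilon>(1) pos(2)] in simp)
  ultimately have "\<forall>\<^sub>F t in at_right 0. \<exists>s. \<bar>s\<bar> \<le> \<epsilon> \<and> g t s = 0"
  proof eventually_elim
    case (elim t)
    then have "g t \<epsilon> \<le> 0" "0 \<le> g t (- \<epsilon>)"
      by (auto simp: divide_less_0_iff zero_less_divide_iff)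
    moreover have "continuous_on {- \<epsilon>..\<epsilon>} (g t)"
      unfolding g_def by (intro continuous_intros)
    ultimately obtain s where "- \<epsilon> \<le> s" "s \<le> \<epsilon>" "g t s = 0"
      using IVT2'[of "g t" \<epsilon> 0 "- \<epsilon>"] \<epsilon>(1) by auto
    then show ?case by (auto intro!: exI[of _ s])
  qed
  then show ?thesis
    using that \<epsilon> unfolding g_def by blast
qed

lemma prepend_zero_col_in_inner_tangent_cone:
  fixes a :: "real^'n" and H :: "real^'m^'n"
  assumes a: "a \<in> balanced_signs"
    and H0: "(\<Sum>i\<in>UNIV. H $ i) = 0"
    and q: "(\<Sum>i\<in>UNIV. a $ i * (norm (H $ i))\<^sup>2) = 0"
  shows "prepend_zero_col H \<in> inner_tangent_cone \<B> (outer a first_basis)"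
proof -
  define c where "c = (\<Sum>i\<in>UNIV. a $ i *\<^sub>R H $ i) /\<^sub>R real CARD('n)"
  define d where "d = (\<lambda>i. a $ i *\<^sub>R H $ i - c)"
  let ?D = "\<lambda>t. infdist (outer a first_basis + t *\<^sub>R prepend_zero_col H) \<B>"

  have d0: "(\<Sum>i\<in>UNIV. d i) = 0"
    by (simp add: d_def c_def sum_subtractf sum_constant_scaleR del: sum_constant)
  \<comment> \<open>Since \<open>d\<close> is the orthogonal projection of \<open>(a\<^sub>i h\<^sub>i)\<^sub>i\<close> to the rows with zero sum, pairing the
    two gives \<open>|d|\<^sup>2\<close>.\<close>
  have slope: "(\<Sum>i\<in>UNIV. a $ i * (H $ i \<bullet> d i)) = (\<Sum>i\<in>UNIV. (norm (d i))\<^sup>2)"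
  proof -
    have "(\<Sum>i\<in>UNIV. a $ i * (H $ i \<bullet> d i)) = (\<Sum>i\<in>UNIV. (norm (d i))\<^sup>2 + c \<bullet> d i)"
      by (intro sum.cong refl) (simp add: power2_norm_eq_inner d_def inner_diff_left)
    also have "\<dots> = (\<Sum>i\<in>UNIV. (norm (d i))\<^sup>2)"
      by (simp add: sum.distrib d0 flip: inner_sum_right)
    finally show ?thesis .
  qed

  \<comment> \<open>The constants \<open>M\<close>, \<open>C\<close> and \<open>E\<close> must not depend on \<open>s\<close>, because the solution \<open>s\<close> of the
    scalar constraint varies with \<open>t\<close>.\<close>
  define M where "M = (\<lambda>i. norm (H $ i) + norm (d i))"
  define C where "C = (\<Sum>i\<in>UNIV. (M i)\<^sup>2)"
  define E where "E = (\<Sum>i\<in>UNIV. norm (d i))"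
  have bound: "?D t \<le> t\<^sup>2 * C + t * (\<bar>s\<bar> * E)"
    if t: "t \<ge> 0" and tM: "\<forall>i. t * M i \<le> 1" and s: "\<bar>s\<bar> \<le> 1"
      and eq: "(\<Sum>i\<in>UNIV. a $ i * sqrt (1 - t\<^sup>2 * (norm (H $ i + s *\<^sub>R d i))\<^sup>2)) = 0" for t s
  proof -
    define z where "z = (\<lambda>i. H $ i + s *\<^sub>R d i)"
    have zM: "norm (z i) \<le> M i" for i
    proof -
      have "norm (z i) \<le> norm (H $ i) + \<bar>s\<bar> * norm (d i)"
        unfolding z_def by (metis norm_triangle_ineq norm_scaleR)
      also have "\<dots> \<le> M i"
        using s by (simp add: M_def mult_left_le_one_le)
      finally show ?thesis .
    qed
    have "?D t \<le> t\<^sup>2 * (\<Sum>i\<in>UNIV. (norm (z i))\<^sup>2) + t * (\<Sum>i\<in>UNIV. norm (z i - H $ i))"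
    proof (rule infdist_\<B>_le[OF a t])
      show "t * norm (z i) \<le> 1" for i
        using mult_left_mono[OF zM[of i] t] tM by (meson order_trans)
      show "(\<Sum>i\<in>UNIV. z i) = 0"
        by (simp add: z_def sum.distrib H0 d0 flip: scaleR_sum_right)
    qed (use eq in \<open>simp add: z_def\<close>)
    also have "(\<Sum>i\<in>UNIV. (norm (z i))\<^sup>2) \<le> C"
      unfolding C_def by (intro sum_mono power_mono zM norm_ge_zero)
    also have "(\<Sum>i\<in>UNIV. norm (z i - H $ i)) = \<bar>s\<bar> * E"
      by (simp add: z_def E_def sum_distrib_left)
    finally show ?thesis by (simp add: mult_left_mono)
  qed

  have solvable: "\<exists>\<epsilon>. 0 < \<epsilon> \<and> \<epsilon> \<le> \<delta> \<and> (\<forall>\<^sub>F t in at_right 0. \<exists>s. \<bar>s\<bar> \<le> \<epsilon> \<and>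
       (\<Sum>i\<in>UNIV. a $ i * sqrt (1 - t\<^sup>2 * (norm (H $ i + s *\<^sub>R d i))\<^sup>2)) = 0)"
    if "\<delta> > 0" for \<delta>
  proof (cases "\<forall>i. d i = 0")
    case True
    have n: "norm (H $ i) = norm c" for i
      using True balanced_signsD(2)[OF a, of i] by (metis d_def eq_iff_diff_eq_0 norm_scaleR mult_1)
    have "(\<Sum>i\<in>UNIV. a $ i * sqrt (1 - t\<^sup>2 * (norm (H $ i + 0 *\<^sub>R d i))\<^sup>2)) = 0" for t
      by (simp add: n balanced_signsD(3)[OF a] flip: sum_distrib_right)
    then show ?thesis
      using \<open>\<delta> > 0\<close> by (intro exI[of _ \<delta>] conjI always_eventually allI exI[of _ 0]) auto
  next
    case False
    then obtain i where "d i \<noteq> 0" by blast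
    then have "(\<Sum>i\<in>UNIV. a $ i * (H $ i \<bullet> d i)) > 0"
      unfolding slope by (intro sum_pos2[of _ i]) auto
    then show ?thesis
      by (rule scalar_constraint_solvable[OF a q _ \<open>\<delta> > 0\<close>]) blast
  qed

  have "?D \<in> o[at_right 0](\<lambda>t. t)"
  proof (rule landau_o.smallI)
    fix \<gamma> :: real assume \<gamma>: "\<gamma> > 0"
    have E: "E \<ge> 0" by (simp add: E_def sum_nonneg)
    define \<delta> where "\<delta> = min 1 (\<gamma> / (2 * (E + 1)))"
    have "\<delta> > 0" using \<gamma> E by (simp add: \<delta>_def)
    obtain \<epsilon> where \<epsilon>: "0 < \<epsilon>" "\<epsilon> \<le> \<delta>"
      and ev: "\<forall>\<^sub>F t in at_right 0. \<exists>s. \<bar>s\<bar> \<le> \<epsilon> \<and>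
         (\<Sum>i\<in>UNIV. a $ i * sqrt (1 - t\<^sup>2 * (norm (H $ i + s *\<^sub>R d i))\<^sup>2)) = 0"
      using solvable[OF \<open>\<delta> > 0\<close>] by (elim exE conjE) (rule that)
    have \<epsilon>1: "\<epsilon> \<le> 1" using \<epsilon> by (simp add: \<delta>_def)
    have "\<epsilon> * E \<le> \<gamma> / 2"
    proof -
      have "\<epsilon> * E \<le> \<gamma> / (2 * (E + 1)) * (E + 1)"
        using \<epsilon> E \<gamma> by (intro mult_mono) (auto simp: \<delta>_def)
      also have "\<dots> = \<gamma> / 2" using E by (simp add: field_simps)
      finally show ?thesis .
    qed
    have small: "\<forall>\<^sub>F t in at_right 0. t * x < y" if "y > 0" for x y :: real
    proof -
      have "((\<lambda>t. t * x) \<longlongrightarrow> 0 * x) (at_right 0)" by (intro tendsto_intros)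
      then show ?thesis using that by (intro order_tendstoD(2)) auto
    qed
    have "\<forall>\<^sub>F t in at_right 0. \<forall>i. t * M i < 1"
      by (intro eventually_all_finite small) simp
    moreover have "\<forall>\<^sub>F t in at_right 0. t * C < \<gamma> / 2"
      using \<gamma> by (intro small) simp
    moreover have "\<forall>\<^sub>F t in at_right 0. (t::real) > 0"
      by (rule eventually_at_right_less)
    ultimately show "\<forall>\<^sub>F t in at_right 0. norm (?D t) \<le> \<gamma> * norm t"
      using ev
    proof eventually_elim
      case (elim t)
      then obtain s where s: "\<bar>s\<bar> \<le> \<epsilon>"
        and "(\<Sum>i\<in>UNIV. a $ i * sqrt (1 - t\<^sup>2 * (norm (H $ i + s *\<^sub>R d i))\<^sup>2)) = 0"
        by blast
      then have "?D t \<le> t\<^sup>2 * C + t * (\<bar>s\<bar> * E)"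
        using elim \<epsilon>1 by (intro bound) (auto intro: less_imp_le)
      also have "\<dots> = t * (t * C + \<bar>s\<bar> * E)"
        by (simp add: algebra_simps power2_eq_square)
      also have "\<dots> \<le> t * \<gamma>"
        using elim \<open>\<epsilon> * E \<le> \<gamma> / 2\<close> mult_right_mono[OF s E] by (intro mult_left_mono) auto
      finally show ?case
        using elim by (simp add: mult.commute abs_of_nonneg infdist_nonneg)
    qed
  qed
  then show ?thesis by (simp add: inner_tangent_cone_def)
qed

section \<open>The tangent cones at a singular point\<close>

theorem proposition3p2:
  fixes a :: "real^'n" and R :: "real^('m::finite option)^'n"
  assumes "CARD('m option) > 1"
    and "a \<in> balanced_signs"
    and "R = outer a first_basis"
    and "singular_point R"
  shows "inner_tangent_cone \<B> R = contingent_cone \<B> R \<and>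
    contingent_cone \<B> R =
      {prepend_zero_col H\<^sub>1 | H\<^sub>1 :: real^'m^'n.
         all_ones v* H\<^sub>1 = 0 \<and> a \<bullet> diag_vec (H\<^sub>1 ** transpose H\<^sub>1) = 0}"
    (is "_ \<and> _ = ?K")
proof -
  have R: "outer a first_basis \<in> (\<B> :: (real^('m option)^'n) set)"
    using assms by (simp add: singular_point_def)
  have "?K \<subseteq> inner_tangent_cone \<B> R"
    using prepend_zero_col_in_inner_tangent_cone[OF assms(2)] assms(3)
    by (auto simp: all_ones_vector_matrix_mult inner_diag_gram)
  moreover have "contingent_cone \<B> R \<subseteq> ?K"
  proof
    fix H assume "H \<in> contingent_cone \<B> R"
    then have "H \<in> contingent_cone \<B> (outer a first_basis)"
      using assms(3) by simp
    note nec = contingent_cone_necessary[OF assms(2) R this]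
    define H\<^sub>1 :: "real^'m^'n" where "H\<^sub>1 = (\<chi> i. row_tail (H $ i))"
    have row: "H $ i = row_cons 0 (H\<^sub>1 $ i)" for i
      using row_cons_collapse[of "H $ i"] by (simp add: nec(1) H\<^sub>1_def)
    then have "H = prepend_zero_col H\<^sub>1"
      by (simp add: vec_eq_iff[of H] prepend_zero_col_nth)
    moreover have "(\<Sum>i\<in>UNIV. H\<^sub>1 $ i) = 0"
    proof -
      have "(\<Sum>i\<in>UNIV. H\<^sub>1 $ i $ k) = 0" for k
        using arg_cong[OF nec(2), of "\<lambda>v. v $ Some k"] by (simp add: row)
      then show ?thesis by (simp add: vec_eq_iff)
    qed
    moreover have "(\<Sum>i\<in>UNIV. a $ i * (norm (H\<^sub>1 $ i))\<^sup>2) = 0"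
      using nec(3) by (simp add: row norm_row_cons_squared)
    ultimately show "H \<in> ?K"
      by (auto simp: all_ones_vector_matrix_mult inner_diag_gram)
  qed
  ultimately show ?thesis
    using inner_tangent_cone_subset_contingent_cone[of \<B> R] by blast
qed

end
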